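(* For every QCL-formula $F$ and every interpretation $\mathcal{I}\subseteq\mathcal{U}$, the value of the game $\mathbf{NG}(\mathbf{P}:F,\mathcal{I})$ (defined in the context) is $\mathrm{deg}^G_\mathcal{I}(F)$.
   Context: QCL-formulas are built from propositional variables (from an infinite set $\mathcal{U}$) using $\neg$, $\wedge$, $\vee$ and the binary connective $\vec{\times}$. An interpretation is a set $\mathcal{I}\subseteq\mathcal{U}$. GCL-optionality: $\mathrm{opt}^G(a)=1$; $\mathrm{opt}^G(\neg F)=\mathrm{opt}^G(F)$; $\mathrm{opt}^G(F\circ G)=\max(\mathrm{opt}^G(F),\mathrm{opt}^G(G))$ for $\circ\in\{\wedge,\vee\}$; $\mathrm{opt}^G(F\vec{\times}G)=\mathrm{opt}^G(F)+\mathrm{opt}^G(G)$. Let $Z=\mathbb{Z}\setminus\{0\}$ with linear order $\trianglelefteq$: on $\mathbb{Z}^+$ and on $\mathbb{Z}^-$ it is the inverse of the natural order, and $b\triangleleft a$ for all $b\in\mathbb{Z}^-$, $a\in\mathbb{Z}^+$ (so $1$ is the top element). GCL-degree: $\mathrm{deg}^G_\mathcal{I}(a)=1$ if $a\in\mathcal{I}$, $-1$ otherwise; $\mathrm{deg}^G_\mathcal{I}(\neg F)=-\mathrm{deg}^G_\mathcal{I}(F)$; $\mathrm{deg}^G_\mathcal{I}(F\wedge G)=\min(\mathrm{deg}^G_\mathcal{I}(F),\mathrm{deg}^G_\mathcal{I}(G))$, $\mathrm{deg}^G_\mathcal{I}(F\vee G)=\max(\mathrm{deg}^G_\mathcal{I}(F),\mathrm{deg}^G_\mathcal{I}(G))$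 (w.r.t. $\trianglelefteq$); $\mathrm{deg}^G_\mathcal{I}(F\vec{\times}G)=\mathrm{deg}^G_\mathcal{I}(F)$ if $\mathrm{deg}^G_\mathcal{I}(F)\in\mathbb{Z}^+$; $=\mathrm{opt}^G(F)+\mathrm{deg}^G_\mathcal{I}(G)$ if $\mathrm{deg}^G_\mathcal{I}(F)\in\mathbb{Z}^-$ and $\mathrm{deg}^G_\mathcal{I}(G)\in\mathbb{Z}^+$; $=\mathrm{deg}^G_\mathcal{I}(F)-\mathrm{opt}^G(G)$ otherwise. The game $\mathbf{NG}(\mathbf{P}:F,\mathcal{I})$ is played between Me and You. Game trees: nodes are game states $\mathbf{Q}:H$ with $\mathbf{Q}\in\{\mathbf{P},\mathbf{O}\}$ (Me as proponent resp. opponent); $\bar{\mathbf{P}}=\mathbf{O}$, $\bar{\mathbf{O}}=\mathbf{P}$. $T(\mathbf{Q}:a)$ is a single leaf $\mathbf{Q}:a$; $T(\mathbf{Q}:\neg G)$ has root $\mathbf{Q}:\neg G$ with single immediate subtree $T(\bar{\mathbf{Q}}:G)$; for $\circ\in\{\wedge,\vee,\vec{\times}\}$, $T(\mathbf{Q}:G_1\circ G_2)$ has root $\mathbf{Q}:G_1\circ G_2$ with immediate subtrees $T(\mathbf{Q}:G_1)$, $T(\mathbf{Q}:G_2)$. At $\mathbf{P}:G_1\wedge G_2$ You choose the successor; at $\mathbf{P}:G_1\vee G_2$ and $\mathbf{P}:G_1\vec{\times}G_2$ I choose; at $\mathbf{O}:G_1\wedge G_2$ I choose; at $\mathbf{O}:G_1\vee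 G_2$ and $\mathbf{O}:G_1\vec{\times}G_2$ You choose. Leaves are outcomes; $\mathcal{O}(\mathbf{Q}:H)$ denotes the leaves of $T(\mathbf{Q}:H)$. Preference relations: $\ll_{\mathbf{P}:a}=\emptyset$; $\ll_{\mathbf{P}:\neg G}=\ll_{\mathbf{O}:G}$; $\ll_{\mathbf{P}:G_1\wedge G_2}=\ll_{\mathbf{P}:G_1\vee G_2}=\ll_{\mathbf{P}:G_1}\cup\ll_{\mathbf{P}:G_2}$; $O_1\ll_{\mathbf{P}:G_1\vec{\times}G_2}O_2$ iff ($O_1\in\mathcal{O}(\mathbf{P}:G_2)$ and $O_2\in\mathcal{O}(\mathbf{P}:G_1)$) or $O_1\ll_{\mathbf{P}:G_j}O_2$ for some $j$; and $\ll_{\mathbf{O}:H}$ is the inverse of $\ll_{\mathbf{P}:H}$ for every $H$. Let $\ll=\ll_{\mathbf{P}:F}$ and $\gg$ its inverse. A leaf $\mathbf{P}:a$ is true iff $a\in\mathcal{I}$; a leaf $\mathbf{O}:a$ is true iff $a\notin\mathcal{I}$; otherwise false. For an outcome $O$, $|\pi_\ll(O)|$ is the maximal $n$ such that there are pairwise distinct outcomes $O=O_1,\dots,O_n$ with $O_i\ll O_{i+1}$ for all $i<n$, and $|\pi_\gg(O)|$ is defined likewise with $\gg$. Payoff: $\delta(O)=|\pi_\ll(O)|$ if $O$ is true and $\delta(O)=-|\pi_\gg(O)|$ if $O$ is false, valued in $(Z,\trianglelefteq)$ (Me wants $\trianglelefteq$-large, You $\trianglelefteq$-small payoff). A strategy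 for Me is a set $\sigma$ of nodes containing the root such that for every $v\in\sigma$: if I choose at $v$ then at least one successor of $v$ is in $\sigma$, otherwise all successors of $v$ are in $\sigma$; strategies for You are symmetric. Each pair $(\sigma_I,\sigma_Y)$ determines a unique outcome with payoff $\delta(\sigma_I,\sigma_Y)$. The value of the game is $\max^{\trianglelefteq}_{\sigma_I}\min^{\trianglelefteq}_{\sigma_Y}\delta(\sigma_I,\sigma_Y)$.
   Formalization: A strategy is required to contain exactly one (not "at least one") successor at each node where its owner chooses, since otherwise a pair of strategies need not determine a unique outcome (e.g. for a ∨ b with the full tree as both strategies). *)

theory Defs
  imports Main "HOL-Library.Sublist" "HOL-Library.Infinite_Typeclass"
begin

datatype 'u qcl =
    Var 'u
  | Neg "'u qcl"
  | Conj "'u qcl" "'u qcl"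
  | Disj "'u qcl" "'u qcl"
  | Choice "'u qcl" "'u qcl"

primrec opt :: "'u qcl \<Rightarrow> nat" where
  "opt (Var a) = 1"
| "opt (Neg F) = opt F"
| "opt (Conj F G) = max (opt F) (opt G)"
| "opt (Disj F G) = max (opt F) (opt G)"
| "opt (Choice F G) = opt F + opt G"

typedef nzint = "{z :: int. z \<noteq> 0}"
  by (rule exI[of _ 1]) simp

setup_lifting type_definition_nzint

text \<open>
  The order on \<open>nzint\<close> is not the one inherited from \<open>int\<close>: it is the order
  \<open>-1 < -2 < -3 < \<dots> < 3 < 2 < 1\<close> in which degrees and payoffs are compared.
\<close>

instantiation nzint :: linorder
begin

lift_definition less_eq_nzint :: "nzint \<Rightarrow> nzint \<Rightarrow> bool" is
  "\<lambda>a b. (a < 0 \<and> 0 < b) \<or> ((0 < a \<longleftrightarrow> 0 < b) \<and> b \<le> a)" .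

definition less_nzint :: "nzint \<Rightarrow> nzint \<Rightarrow> bool" where
  "less_nzint a b \<longleftrightarrow> a \<le> b \<and> \<not> b \<le> a"

instance
  by standard (unfold less_nzint_def, (transfer, auto)+)

end

instantiation nzint :: "{one, uminus}"
begin

lift_definition one_nzint :: nzint is 1 by simp

lift_definition uminus_nzint :: "nzint \<Rightarrow> nzint" is "\<lambda>z. - z" by simp

instance ..

end

text \<open>
  Both arguments of \<open>Abs_nzint\<close> below are nonzero, see \<open>Rep_deg_Choice\<close>.
\<close>

primrec deg :: "'u set \<Rightarrow> 'u qcl \<Rightarrow> nzint" where
  "deg I (Var a) = (if a \<in> I then 1 else - 1)"
| "deg I (Neg F) = - deg I F"
| "deg I (Conj F G) = min (deg I F) (deg I G)"
| "deg I (Disj F G) = max (deg I F) (deg I G)"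
| "deg I (Choice F G) =
    (if 0 < Rep_nzint (deg I F) then deg I F
     else if 0 < Rep_nzint (deg I G) then Abs_nzint (int (opt F) + Rep_nzint (deg I G))
     else Abs_nzint (Rep_nzint (deg I F) - int (opt G)))"

lemma Rep_deg_Choice:
  "Rep_nzint (deg I (Choice F G)) =
    (if 0 < Rep_nzint (deg I F) then Rep_nzint (deg I F)
     else if 0 < Rep_nzint (deg I G) then int (opt F) + Rep_nzint (deg I G)
     else Rep_nzint (deg I F) - int (opt G))"
  using Rep_nzint[of "deg I F"] by (auto simp: Abs_nzint_inverse)


datatype role = Proponent | Opponent

primrec dual :: "role \<Rightarrow> role" where
  "dual Proponent = Opponent"
| "dual Opponent = Proponent"

datatype player = Me | You

type_synonym 'u game_state = "role \<times> 'u qcl"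

datatype 'u gtree = Node (root_state: "'u game_state") (subtrees: "'u gtree list")

primrec game_tree :: "'u qcl \<Rightarrow> role \<Rightarrow> 'u gtree" where
  "game_tree (Var a) Q = Node (Q, Var a) []"
| "game_tree (Neg G) Q = Node (Q, Neg G) [game_tree G (dual Q)]"
| "game_tree (Conj G1 G2) Q = Node (Q, Conj G1 G2) [game_tree G1 Q, game_tree G2 Q]"
| "game_tree (Disj G1 G2) Q = Node (Q, Disj G1 G2) [game_tree G1 Q, game_tree G2 Q]"
| "game_tree (Choice G1 G2) Q = Node (Q, Choice G1 G2) [game_tree G1 Q, game_tree G2 Q]"

text \<open>
  The nodes of a tree are addressed by their positions (lists of child indices from the root),
  so that different occurrences of the same game state are different nodes.
\<close>

type_synonym pos = "nat list"

fun subtree_at :: "'u gtree \<Rightarrow> pos \<Rightarrow> 'u gtree option" where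
  "subtree_at t [] = Some t"
| "subtree_at (Node s ts) (i # p) = (if i < length ts then subtree_at (ts ! i) p else None)"

definition nodes :: "'u gtree \<Rightarrow> pos set" where
  "nodes t = {p. subtree_at t p \<noteq> None}"

definition state_at :: "'u gtree \<Rightarrow> pos \<Rightarrow> 'u game_state" where
  "state_at t p = root_state (the (subtree_at t p))"

definition successors :: "'u gtree \<Rightarrow> pos \<Rightarrow> pos set" where
  "successors t p = {p @ [i] | i. p @ [i] \<in> nodes t}"

definition outcomes :: "'u gtree \<Rightarrow> pos set" where
  "outcomes t = {p \<in> nodes t. successors t p = {}}"

fun chooser :: "'u game_state \<Rightarrow> player option" where
  "chooser (Proponent, Conj _ _) = Some You"
| "chooser (Proponent, Disj _ _) = Some Me"
| "chooser (Proponent, Choice _ _) = Some Me"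
| "chooser (Opponent, Conj _ _) = Some Me"
| "chooser (Opponent, Disj _ _) = Some You"
| "chooser (Opponent, Choice _ _) = Some You"
| "chooser (_, Neg _) = None"
| "chooser (_, Var _) = None"


definition in_child :: "nat \<Rightarrow> pos rel \<Rightarrow> pos rel" where
  "in_child i R = {(i # p, i # q) | p q. (p, q) \<in> R}"

text \<open>
  \<open>(p, q) \<in> pref Q H\<close> means that the outcome at \<open>q\<close> is preferred to the one at \<open>p\<close> in the game
  tree of \<open>(Q, H)\<close>. The trees of \<open>(Proponent, H)\<close> and \<open>(Opponent, H)\<close> have the same positions;
  this is the identification of their outcomes under which one relation is the inverse of the
  other.
\<close>

function (sequential) pref :: "role \<Rightarrow> 'u qcl \<Rightarrow> pos rel" where
  "pref Proponent (Var a) = {}"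
| "pref Proponent (Neg G) = in_child 0 (pref Opponent G)"
| "pref Proponent (Conj G1 G2) =
    in_child 0 (pref Proponent G1) \<union> in_child 1 (pref Proponent G2)"
| "pref Proponent (Disj G1 G2) =
    in_child 0 (pref Proponent G1) \<union> in_child 1 (pref Proponent G2)"
| "pref Proponent (Choice G1 G2) =
    {(1 # p, 0 # q) | p q.
       p \<in> outcomes (game_tree G2 Proponent) \<and> q \<in> outcomes (game_tree G1 Proponent)} \<union>
    in_child 0 (pref Proponent G1) \<union> in_child 1 (pref Proponent G2)"
| "pref Opponent H = (pref Proponent H)\<inverse>"
  by pat_completeness auto
termination
  by (relation "measure (\<lambda>(Q, H). 2 * size H + (case Q of Proponent \<Rightarrow> 0 | Opponent \<Rightarrow> 1))") auto

definition max_chain :: "'a set \<Rightarrow> 'a rel \<Rightarrow> 'a \<Rightarrow> nat" where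
  "max_chain A R p = Max {length xs | xs. xs \<noteq> [] \<and> hd xs = p \<and> distinct xs \<and>
     set xs \<subseteq> A \<and> successively (\<lambda>x y. (x, y) \<in> R) xs}"

fun true_state :: "'u set \<Rightarrow> 'u game_state \<Rightarrow> bool" where
  "true_state I (Proponent, Var a) \<longleftrightarrow> a \<in> I"
| "true_state I (Opponent, Var a) \<longleftrightarrow> a \<notin> I"
| "true_state I _ \<longleftrightarrow> False"

definition payoff :: "'u qcl \<Rightarrow> 'u set \<Rightarrow> pos \<Rightarrow> nzint" where
  "payoff F I p =
    (let t = game_tree F Proponent; R = pref Proponent F in
     if true_state I (state_at t p)
     then Abs_nzint (int (max_chain (outcomes t) R p))
     else Abs_nzint (- int (max_chain (outcomes t) (R\<inverse>) p)))"

text \<open>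
  A player fixes exactly one successor at each node of the strategy where this player is to
  choose; otherwise a pair of strategies would not determine a unique outcome.
\<close>

definition strategy :: "player \<Rightarrow> 'u gtree \<Rightarrow> pos set \<Rightarrow> bool" where
  "strategy X t \<sigma> \<longleftrightarrow> \<sigma> \<subseteq> nodes t \<and> [] \<in> \<sigma> \<and>
    (\<forall>v\<in>\<sigma>. if chooser (state_at t v) = Some X
            then \<exists>!w. w \<in> successors t v \<and> w \<in> \<sigma>
            else successors t v \<subseteq> \<sigma>)"

definition is_outcome :: "'u gtree \<Rightarrow> pos set \<Rightarrow> pos set \<Rightarrow> pos \<Rightarrow> bool" where
  "is_outcome t \<sigma>\<^sub>I \<sigma>\<^sub>Y p \<longleftrightarrow> p \<in> outcomes t \<and> (\<forall>q. prefix q p \<longrightarrow> q \<in> \<sigma>\<^sub>I \<and> q \<in> \<sigma>\<^sub>Y)"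

definition the_outcome :: "'u gtree \<Rightarrow> pos set \<Rightarrow> pos set \<Rightarrow> pos" where
  "the_outcome t \<sigma>\<^sub>I \<sigma>\<^sub>Y = (THE p. is_outcome t \<sigma>\<^sub>I \<sigma>\<^sub>Y p)"

definition game_value :: "'u qcl \<Rightarrow> 'u set \<Rightarrow> nzint" where
  "game_value F I =
    (let t = game_tree F Proponent in
     MAX \<sigma>\<^sub>I \<in> {\<sigma>. strategy Me t \<sigma>}. MIN \<sigma>\<^sub>Y \<in> {\<sigma>. strategy You t \<sigma>}.
       payoff F I (the_outcome t \<sigma>\<^sub>I \<sigma>\<^sub>Y))"


text \<open>
  Well-definedness: the maxima and minima above range over finite nonempty sets, the arguments
  of \<open>Abs_nzint\<close> in \<open>payoff\<close> are nonzero, and strategies determine a unique outcome.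
\<close>

lemma nodes_Node: "nodes (Node s ts) = insert [] (\<Union>i<length ts. (#) i ` nodes (ts ! i))"
  (is "?L = ?R")
proof (rule set_eqI)
  fix p show "p \<in> ?L \<longleftrightarrow> p \<in> ?R"
    by (cases p) (auto simp: nodes_def split: if_splits)
qed

lemma finite_nodes: "finite (nodes t)"
  by (induction t) (auto simp: nodes_Node)

lemma finite_outcomes: "finite (outcomes t)"
  unfolding outcomes_def using finite_nodes[of t] by simp

lemma finite_strategies: "finite {\<sigma>. strategy X t \<sigma>}"
  by (rule finite_subset[of _ "Pow (nodes t)"]) (auto simp: strategy_def finite_nodes)

lemma nodes_Nil [simp]: "[] \<in> nodes t"
  by (simp add: nodes_def)

lemma nodes_snocD: "p @ [i] \<in> nodes t \<Longrightarrow> p \<in> nodes t"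
  by (induction t p rule: subtree_at.induct) (auto simp: nodes_def split: if_splits)

lemma max_chain_pos:
  assumes "finite A" and "p \<in> A"
  shows "0 < max_chain A R p"
proof -
  let ?S = "{length xs | xs. xs \<noteq> [] \<and> hd xs = p \<and> distinct xs \<and>
     set xs \<subseteq> A \<and> successively (\<lambda>x y. (x, y) \<in> R) xs}"
  have "?S \<subseteq> {..card A}"
    using assms(1) by (auto simp flip: distinct_card intro!: card_mono)
  then have "finite ?S"
    using finite_subset by blast
  moreover have "1 \<in> ?S"
    using assms(2) by (intro CollectI exI[of _ "[p]"]) simp
  ultimately have "1 \<le> Max ?S"
    by (rule Max_ge)
  then show ?thesis
    by (simp add: max_chain_def)
qed

lemma Rep_payoff:
  fixes F :: "'u qcl"
  defines "t \<equiv> game_tree F Proponent" and "R \<equiv> pref Proponent F"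
  assumes "p \<in> outcomes t"
  shows "Rep_nzint (payoff F I p) =
    (if true_state I (state_at t p) then int (max_chain (outcomes t) R p)
     else - int (max_chain (outcomes t) (R\<inverse>) p))"
  using max_chain_pos[OF finite_outcomes, of p t R]
    max_chain_pos[OF finite_outcomes, of p t "R\<inverse>"] assms(3)
  by (simp add: payoff_def Let_def Abs_nzint_inverse flip: t_def R_def)

lemma subtree_at_game_tree:
  "subtree_at (game_tree F Q) p = Some t \<Longrightarrow> \<exists>H Q'. t = game_tree H Q'"
proof (induction F arbitrary: Q p)
  case (Var a)
  then show ?case
    by (cases p) (auto intro: game_tree.simps[symmetric])
next
  case (Neg F)
  then show ?case
    by (cases p) (auto split: if_splits intro: game_tree.simps[symmetric])
next
  case (Conj F G)
  then show ?case
    by (cases p) (auto simp: less_Suc_eq split: if_splits intro: game_tree.simps[symmetric])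
next
  case (Disj F G)
  then show ?case
    by (cases p) (auto simp: less_Suc_eq split: if_splits intro: game_tree.simps[symmetric])
next
  case (Choice F G)
  then show ?case
    by (cases p) (auto simp: less_Suc_eq split: if_splits intro: game_tree.simps[symmetric])
qed

lemma subtree_at_append:
  "subtree_at t (p @ q) = Option.bind (subtree_at t p) (\<lambda>u. subtree_at u q)"
  by (induction t p rule: subtree_at.induct) auto

lemma successors_no_chooser:
  assumes "chooser (state_at (game_tree F Q) v) = None"
    and "v @ [i] \<in> nodes (game_tree F Q)"
  shows "i = 0"
proof -
  obtain t where t: "subtree_at (game_tree F Q) v = Some t"
    using nodes_snocD[OF assms(2)] by (auto simp: nodes_def)
  obtain Q' H where H: "t = game_tree H Q'"
    using subtree_at_game_tree[OF t] by blast
  show ?thesis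
    using assms t H
    by (cases H; cases Q') (auto simp: state_at_def nodes_def subtree_at_append split: if_splits)
qed

lemma successors_0:
  assumes "v @ [i] \<in> nodes t"
  shows "v @ [0] \<in> nodes t"
proof -
  obtain u where "subtree_at t v = Some u"
    using nodes_snocD[OF assms] by (auto simp: nodes_def)
  with assms show ?thesis
    by (cases u) (auto simp: nodes_def subtree_at_append split: if_splits)
qed

lemma chooser_successors:
  assumes "v \<in> nodes (game_tree F Q)" and "chooser (state_at (game_tree F Q) v) = Some X"
  shows "successors (game_tree F Q) v \<noteq> {}"
proof -
  obtain t where t: "subtree_at (game_tree F Q) v = Some t"
    using assms(1) by (auto simp: nodes_def)
  obtain Q' H where H: "t = game_tree H Q'"
    using subtree_at_game_tree[OF t] by blast
  have "v @ [0] \<in> nodes (game_tree F Q)"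
    using assms t H
    by (cases H; cases Q') (auto simp: state_at_def nodes_def subtree_at_append)
  then show ?thesis by (auto simp: successors_def)
qed

lemma strategies_nonempty: "{\<sigma>. strategy X (game_tree F Q) \<sigma>} \<noteq> {}"
proof -
  define t where t: "t = game_tree F Q"
  define \<sigma> where "\<sigma> = {p \<in> nodes t. \<forall>v i. prefix (v @ [i]) p \<longrightarrow>
    chooser (state_at t v) = Some X \<longrightarrow> i = 0}"
  have step: "v @ [i] \<in> \<sigma> \<longleftrightarrow>
      v @ [i] \<in> nodes t \<and> (chooser (state_at t v) = Some X \<longrightarrow> i = 0)"
    if "v \<in> \<sigma>" for v i
    using that unfolding \<sigma>_def by auto
  have "strategy X t \<sigma>"
    unfolding strategy_def
  proof (intro conjI ballI)
    show "\<sigma> \<subseteq> nodes t" by (auto simp: \<sigma>_def)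
    show "[] \<in> \<sigma>" by (simp add: \<sigma>_def)
    fix v assume v: "v \<in> \<sigma>"
    show "if chooser (state_at t v) = Some X
          then \<exists>!w. w \<in> successors t v \<and> w \<in> \<sigma> else successors t v \<subseteq> \<sigma>"
    proof (cases "chooser (state_at t v) = Some X")
      case True
      have "\<exists>!w. w \<in> successors t v \<and> w \<in> \<sigma>" if "successors t v \<noteq> {}"
      proof (rule ex1I[of _ "v @ [0]"])
        show "v @ [0] \<in> successors t v \<and> v @ [0] \<in> \<sigma>"
          using that step[OF v] by (auto simp: successors_def dest: successors_0)
        show "w = v @ [0]" if "w \<in> successors t v \<and> w \<in> \<sigma>" for w
          using that step[OF v] True by (auto simp: successors_def)
      qed
      moreover have "successors t v \<noteq> {}"
        using True chooser_successors[of v F Q X] v by (auto simp: \<sigma>_def t)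
      ultimately show ?thesis using True by simp
    next
      case False
      then show ?thesis
        using step[OF v] by (auto simp: successors_def)
    qed
  qed
  then show ?thesis unfolding t by auto
qed

lemma unique_outcome:
  fixes F :: "'u qcl" and Q :: role
  defines "t \<equiv> game_tree F Q"
  assumes I: "strategy Me t \<sigma>\<^sub>I" and Y: "strategy You t \<sigma>\<^sub>Y"
  shows "\<exists>!p. is_outcome t \<sigma>\<^sub>I \<sigma>\<^sub>Y p"
proof -
  have one: "\<exists>!w. w \<in> successors t v \<and> w \<in> \<sigma>\<^sub>I \<and> w \<in> \<sigma>\<^sub>Y"
    if v: "v \<in> \<sigma>\<^sub>I" "v \<in> \<sigma>\<^sub>Y" and ne: "successors t v \<noteq> {}" for v
  proof (cases "chooser (state_at t v)")
    case None
    have "successors t v \<subseteq> \<sigma>\<^sub>I" "successors t v \<subseteq> \<sigma>\<^sub>Y"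
      using I Y v None unfolding strategy_def by auto
    moreover have "w = v @ [0]" if "w \<in> successors t v" for w
      using that None successors_no_chooser unfolding t_def successors_def by blast
    ultimately show ?thesis using ne by blast
  next
    case (Some X)
    show ?thesis
    proof (cases X)
      case Me
      then have "\<exists>!w. w \<in> successors t v \<and> w \<in> \<sigma>\<^sub>I" "successors t v \<subseteq> \<sigma>\<^sub>Y"
        using I Y v Some unfolding strategy_def by auto
      then show ?thesis by blast
    next
      case You
      then have "\<exists>!w. w \<in> successors t v \<and> w \<in> \<sigma>\<^sub>Y" "successors t v \<subseteq> \<sigma>\<^sub>I"
        using I Y v Some unfolding strategy_def by auto
      then show ?thesis by blast
    qed
  qed
  define S where "S = {p. \<forall>q. prefix q p \<longrightarrow> q \<in> \<sigma>\<^sub>I \<and> q \<in> \<sigma>\<^sub>Y}"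
  have S_sub: "S \<subseteq> nodes t"
    using I by (auto simp: S_def strategy_def)
  have "[] \<in> S"
    using I Y by (auto simp: S_def strategy_def)
  moreover have fin: "finite S"
    using finite_subset[OF S_sub finite_nodes] .
  ultimately have "Max (length ` S) \<in> length ` S"
    by (intro Max_in) auto
  then obtain p where p: "p \<in> S" and "length p = Max (length ` S)"
    by auto
  then have p_max: "length q \<le> length p" if "q \<in> S" for q
    using fin that by simp
  have "successors t p = {}"
  proof (rule ccontr)
    assume "successors t p \<noteq> {}"
    then obtain i where "p @ [i] \<in> \<sigma>\<^sub>I" "p @ [i] \<in> \<sigma>\<^sub>Y"
      using one[of p] p by (auto simp: S_def successors_def)
    then have "p @ [i] \<in> S"
      using p by (auto simp: S_def)
    from p_max[OF this] show False by simp
  qed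
  then have "is_outcome t \<sigma>\<^sub>I \<sigma>\<^sub>Y p"
    using p S_sub by (auto simp: is_outcome_def outcomes_def S_def)
  moreover have "p = q" if p: "is_outcome t \<sigma>\<^sub>I \<sigma>\<^sub>Y p" and q: "is_outcome t \<sigma>\<^sub>I \<sigma>\<^sub>Y q" for p q
  proof -
    have maximal: "r = s"
      if r: "is_outcome t \<sigma>\<^sub>I \<sigma>\<^sub>Y r" and s: "is_outcome t \<sigma>\<^sub>I \<sigma>\<^sub>Y s" and rs: "prefix r s" for r s
    proof (rule ccontr)
      assume "r \<noteq> s"
      then obtain i u where "s = r @ i # u"
        using rs by (metis append_Nil2 list.exhaust prefixE)
      then have "s = (r @ [i]) @ u" by simp
      then have "prefix (r @ [i]) s" by (rule prefixI)
      then have "r @ [i] \<in> nodes t"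
        using s I by (auto simp: is_outcome_def strategy_def)
      with r show False
        by (auto simp: is_outcome_def outcomes_def successors_def)
    qed
    show ?thesis
    proof (cases "p \<parallel> q")
      case True
      then obtain v i p' j q' where ij: "i \<noteq> j" "p = v @ i # p'" "q = v @ j # q'"
        using parallel_decomp by blast
      then have "prefix v p" "prefix (v @ [i]) p" "prefix (v @ [j]) q"
        by auto
      then have *: "v \<in> \<sigma>\<^sub>I" "v \<in> \<sigma>\<^sub>Y" "v @ [i] \<in> \<sigma>\<^sub>I" "v @ [i] \<in> \<sigma>\<^sub>Y" "v @ [j] \<in> \<sigma>\<^sub>I" "v @ [j] \<in> \<sigma>\<^sub>Y"
        using p q by (auto simp: is_outcome_def)
      then have "v @ [i] \<in> successors t v" "v @ [j] \<in> successors t v"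
        using I by (auto simp: successors_def strategy_def)
      with one[of v] * have "v @ [i] = v @ [j]" by blast
      with ij show ?thesis by simp
    next
      case False
      then show ?thesis using maximal p q by blast
    qed
  qed
  ultimately show ?thesis by blast
qed

end

theory Submission
  imports Defs
begin

text \<open>
  The longest preference chain among the outcomes of \<open>F\<close> has length \<open>opt F\<close>, in either direction.
  Hence passing from \<open>F\<close> or \<open>G\<close> to \<open>Choice F G\<close> changes payoffs by monotone maps: true outcomes
  of \<open>G\<close> are shifted by \<open>opt F\<close>, false outcomes of \<open>F\<close> by \<open>- opt G\<close>, and all others keep their
  payoff. By induction on \<open>F\<close>, I can therefore secure \<open>deg I F\<close> as proponent and \<open>- deg I F\<close> as
  opponent. Exchanging the roles exchanges the players and negates all payoffs, so the second
  statement says that You can hold Me down to \<open>deg I F\<close>.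
\<close>

section \<open>Maximal chains\<close>

definition chain_from :: "'a set \<Rightarrow> 'a rel \<Rightarrow> 'a \<Rightarrow> 'a list \<Rightarrow> bool" where
  "chain_from A R p xs \<longleftrightarrow> xs \<noteq> [] \<and> hd xs = p \<and> distinct xs \<and>
     set xs \<subseteq> A \<and> successively (\<lambda>x y. (x, y) \<in> R) xs"

lemma max_chain_chain_from: "max_chain A R p = Max {length xs | xs. chain_from A R p xs}"
  by (simp add: max_chain_def chain_from_def)

lemma finite_chain_lengths:
  assumes "finite A"
  shows "finite {length xs | xs. chain_from A R p xs}"
proof (rule finite_subset)
  show "{length xs | xs. chain_from A R p xs} \<subseteq> {..card A}"
    using assms by (auto simp: chain_from_def simp flip: distinct_card intro!: card_mono)
qed simp

lemma length_chain_le_max_chain: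
  assumes "finite A" and "chain_from A R p xs"
  shows "length xs \<le> max_chain A R p"
  unfolding max_chain_chain_from
  using assms by (intro Max_ge finite_chain_lengths) auto

lemma max_chain_attained:
  assumes "finite A" and "p \<in> A"
  obtains xs where "chain_from A R p xs" and "length xs = max_chain A R p"
proof -
  have "chain_from A R p [p]"
    using assms(2) by (simp add: chain_from_def)
  then have "{length xs | xs. chain_from A R p xs} \<noteq> {}"
    by blast
  from Max_in[OF finite_chain_lengths[OF assms(1)] this] show ?thesis
    using that unfolding max_chain_chain_from by force
qed

text \<open>The length bound \<open>n\<close> alone makes the set of lengths finite, so that
  \<open>Max\<close> is meaningful.\<close>

lemma max_chain_eqI:
  assumes "chain_from A R p xs" and "length xs = n"
    and le: "\<And>ys. chain_from A R p ys \<Longrightarrow> length ys \<le> n"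
  shows "max_chain A R p = n"
  unfolding max_chain_chain_from
proof (rule Max_eqI)
  show "finite {length xs | xs. chain_from A R p xs}"
    by (rule finite_subset[of _ "{..n}"]) (use le in auto)
  show "n \<in> {length xs | xs. chain_from A R p xs}"
    using assms by blast
qed (use le in auto)

lemma chain_from_Cons:
  "chain_from A R p (x # xs) \<longleftrightarrow> x = p \<and> p \<in> A \<and> p \<notin> set xs \<and>
     (xs = [] \<or> (p, hd xs) \<in> R \<and> chain_from A R (hd xs) xs)"
  by (cases xs) (auto simp: chain_from_def)

lemma chain_from_map:
  assumes "inj f" and "f ` A \<subseteq> A'"
    and "\<And>x y. x \<in> A \<Longrightarrow> y \<in> A \<Longrightarrow> (x, y) \<in> R \<Longrightarrow> (f x, f y) \<in> R'"
    and "chain_from A R p xs"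
  shows "chain_from A' R' (f p) (map f xs)"
  using assms(4)
proof (induction xs arbitrary: p)
  case (Cons x xs)
  then show ?case
    using assms(1-3)
    by (cases xs) (auto simp: chain_from_Cons dest: injD)
qed (simp add: chain_from_def)

text \<open>By \<open>step\<close>, a step inside \<open>A'\<close> from the image of
  \<open>A\<close> can only lead to the image of an \<open>R\<close>-successor. Chains from
  \<open>f p\<close> are therefore exactly the images of chains from \<open>p\<close>.\<close>

lemma max_chain_embed:
  assumes "finite A" and "p \<in> A" and inj: "inj f" and sub: "f ` A \<subseteq> A'"
    and step: "\<And>x y. x \<in> A \<Longrightarrow> y \<in> A' \<Longrightarrow>
      (f x, y) \<in> R' \<longleftrightarrow> (\<exists>z\<in>A. y = f z \<and> (x, z) \<in> R)"
  shows "max_chain A' R' (f p) = max_chain A R p"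
proof -
  obtain xs where xs: "chain_from A R p xs" "length xs = max_chain A R p"
    using max_chain_attained[OF assms(1,2)] .
  have "\<exists>zs. chain_from A R p zs \<and> ys = map f zs"
    if "chain_from A' R' (f p) ys" "p \<in> A" for ys p
    using that
  proof (induction ys arbitrary: p)
    case (Cons y ys)
    show ?case
    proof (cases "ys = []")
      case True
      then show ?thesis
        using Cons.prems by (intro exI[of _ "[p]"]) (auto simp: chain_from_Cons)
    next
      case False
      then have *: "(f p, hd ys) \<in> R'" "chain_from A' R' (hd ys) ys" "y = f p" "f p \<notin> set ys"
        using Cons.prems by (auto simp: chain_from_Cons)
      then have "hd ys \<in> A'"
        using False by (auto simp: chain_from_def)
      then obtain z where z: "z \<in> A" "hd ys = f z" "(p, z) \<in> R"
        using step[OF \<open>p \<in> A\<close>] * by blast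
      then obtain zs where zs: "chain_from A R z zs" "ys = map f zs"
        using Cons.IH[of z] * by auto
      have "chain_from A R p (p # zs)"
        using z zs * \<open>p \<in> A\<close> False by (auto simp: chain_from_Cons) (auto simp: chain_from_def)
      then show ?thesis
        using zs * by (intro exI[of _ "p # zs"]) auto
    qed
  qed (simp add: chain_from_def)
  then have "length ys \<le> max_chain A R p" if "chain_from A' R' (f p) ys" for ys
    using that assms(1,2) length_chain_le_max_chain by fastforce
  moreover have "chain_from A' R' (f p) (map f xs)"
    using chain_from_map[OF inj sub _ xs(1)] step sub by blast
  ultimately show ?thesis
    using xs(2) by (intro max_chain_eqI[of _ _ _ "map f xs"]) auto
qed

text \<open>\<open>R'\<close> stacks the image of \<open>B\<close> on top of that of
  \<open>A\<close>: every point of the lower block precedes every point of the upper one, and no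
  step leads back. A longest chain from \<open>f p\<close> follows a longest chain of the lower
  block and continues with one of length \<open>m\<close>, starting at \<open>g b\<close>.\<close>

lemma max_chain_series:
  assumes A: "finite A" "p \<in> A" and B: "finite B" "b \<in> B" "max_chain B S b = m"
    and m: "\<And>c. c \<in> B \<Longrightarrow> max_chain B S c \<le> m"
    and inj: "inj f" "inj g" and disj: "range f \<inter> range g = {}"
    and C: "C = f ` A \<union> g ` B"
    and step_f: "\<And>x y. x \<in> A \<Longrightarrow> y \<in> C \<Longrightarrow>
      (f x, y) \<in> R' \<longleftrightarrow> (\<exists>z\<in>A. y = f z \<and> (x, z) \<in> R) \<or> y \<in> g ` B"
    and step_g: "\<And>x y. x \<in> B \<Longrightarrow> y \<in> C \<Longrightarrow>
      (g x, y) \<in> R' \<longleftrightarrow> (\<exists>z\<in>B. y = g z \<and> (x, z) \<in> S)"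
  shows "max_chain C R' (f p) = max_chain A R p + m"
proof -
  have finC: "finite C"
    using A B C by simp
  have max_g: "max_chain C R' (g c) = max_chain B S c" if "c \<in> B" for c
    using that B(1) inj(2) C step_g by (intro max_chain_embed) auto
  \<comment> \<open>A chain splits where it enters the upper block, which it cannot leave. Of the
    upper part \<open>vs\<close> only the length is recorded.\<close>
  have upper: "\<exists>us vs. chain_from A R p us \<and> ys = map f us @ vs \<and> length vs \<le> m"
    if "chain_from C R' (f p) ys" "p \<in> A" for ys p
    using that
  proof (induction ys arbitrary: p)
    case (Cons y ys)
    show ?case
    proof (cases "ys = []")
      case True
      then show ?thesis
        using Cons.prems
        by (intro exI[of _ "[p]"] exI[of _ "[]"]) (auto simp: chain_from_Cons)
    next
      case False
      then have *: "(f p, hd ys) \<in> R'" "chain_from C R' (hd ys) ys" "y = f p" "f p \<notin> set ys"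
        using Cons.prems by (auto simp: chain_from_Cons)
      then have "hd ys \<in> C"
        using False by (auto simp: chain_from_def)
      with step_f[OF \<open>p \<in> A\<close>] *
      consider z where "z \<in> A" "hd ys = f z" "(p, z) \<in> R" | c where "c \<in> B" "hd ys = g c"
        by blast
      then show ?thesis
      proof cases
        case 1
        then obtain us vs where us: "chain_from A R z us" "ys = map f us @ vs" "length vs \<le> m"
          using Cons.IH[of z] * by auto
        have "chain_from A R p (p # us)"
          using 1 us * \<open>p \<in> A\<close> by (auto simp: chain_from_Cons) (auto simp: chain_from_def)
        then show ?thesis
          using us * by (intro exI[of _ "p # us"] exI[of _ vs]) auto
      next
        case 2
        then have "length ys \<le> m"
          using length_chain_le_max_chain[OF finC *(2)] max_g m by fastforce
        then show ?thesis
          using * \<open>p \<in> A\<close>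
          by (intro exI[of _ "[p]"] exI[of _ ys]) (auto simp: chain_from_Cons)
      qed
    qed
  qed (simp add: chain_from_def)
  obtain us where us: "chain_from A R p us" "length us = max_chain A R p"
    using max_chain_attained[OF A] .
  obtain vs where vs: "chain_from B S b vs" "length vs = m"
    using max_chain_attained[OF B(1,2)] B(3) by metis
  have fus: "chain_from C R' (f p) (map f us)"
    using step_f C by (intro chain_from_map[OF inj(1) _ _ us(1)]) auto
  have gvs: "chain_from C R' (g b) (map g vs)"
    using step_g C by (intro chain_from_map[OF inj(2) _ _ vs(1)]) auto
  have ne: "us \<noteq> []" "vs \<noteq> []" "set us \<subseteq> A" "hd vs = b"
    using us vs by (auto simp: chain_from_def)
  then have "last us \<in> A"
    by auto
  then have "(f (last us), g b) \<in> R'"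
    using step_f[of "last us" "g b"] B(2) C by auto
  \<comment> \<open>The step from \<open>f (last us)\<close> to \<open>g b\<close> joins both
    chains; \<open>disj\<close> keeps the concatenation distinct.\<close>
  then have "chain_from C R' (f p) (map f us @ map g vs)"
    using fus gvs ne disj
    by (auto simp: chain_from_def successively_append_iff last_map hd_map)
  then show ?thesis
  proof (rule max_chain_eqI)
    show "length (map f us @ map g vs) = max_chain A R p + m"
      using us vs by simp
    fix ys assume "chain_from C R' (f p) ys"
    from upper[OF this A(2)] show "length ys \<le> max_chain A R p + m"
      using length_chain_le_max_chain[OF A(1)] by (fastforce intro: add_mono)
  qed
qed

section \<open>Positions and preferences in game trees\<close>

lemma successors_Node_Nil: "successors (Node s ts) [] = {[i] | i. i < length ts}"
  by (auto simp: successors_def nodes_Node image_iff)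

lemma successors_Node_Cons:
  "i < length ts \<Longrightarrow> successors (Node s ts) (i # p) = (#) i ` successors (ts ! i) p"
  by (auto simp: successors_def nodes_Node)

lemma state_at_Node [simp]:
  "state_at (Node s ts) [] = s"
  "i < length ts \<Longrightarrow> state_at (Node s ts) (i # p) = state_at (ts ! i) p"
  by (simp_all add: state_at_def)

lemma outcomes_Node:
  "outcomes (Node s ts) =
    (if ts = [] then {[]} else (\<Union>i<length ts. (#) i ` outcomes (ts ! i)))"
  by (cases "ts = []")
    (auto simp: outcomes_def nodes_Node successors_Node_Nil successors_Node_Cons dest: spec[of _ 0])

lemma lessThan_2: "{..<Suc (Suc 0)} = {0, 1}"
  by auto

text \<open>Roles label the states but do not affect the shape of a tree. Hence both roles share one
  set of outcome positions, on which their preferences are converse to each other.\<close>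

lemma nodes_game_tree_role: "nodes (game_tree F Q) = nodes (game_tree F Q')"
proof (induction F arbitrary: Q Q')
  case (Neg F)
  show ?case
    using Neg[of "dual Q" "dual Q'"] by (simp add: nodes_Node)
next
  case (Conj F G)
  show ?case
    using Conj(1)[of Q Q'] Conj(2)[of Q Q'] by (simp add: nodes_Node lessThan_2)
next
  case (Disj F G)
  show ?case
    using Disj(1)[of Q Q'] Disj(2)[of Q Q'] by (simp add: nodes_Node lessThan_2)
next
  case (Choice F G)
  show ?case
    using Choice(1)[of Q Q'] Choice(2)[of Q Q'] by (simp add: nodes_Node lessThan_2)
qed (simp add: nodes_Node)

lemma successors_game_tree_role: "successors (game_tree F Q) = successors (game_tree F Q')"
  by (rule ext) (simp add: successors_def nodes_game_tree_role[of F Q Q'])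

lemma outcomes_game_tree_role: "outcomes (game_tree F Q) = outcomes (game_tree F Q')"
  by (simp add: outcomes_def nodes_game_tree_role[of F Q Q'] successors_game_tree_role[of F Q Q'])

definition outs :: "'u qcl \<Rightarrow> pos set" where
  "outs F = outcomes (game_tree F Proponent)"

lemma outcomes_game_tree: "outcomes (game_tree F Q) = outs F"
  unfolding outs_def by (rule outcomes_game_tree_role)

lemma finite_outs: "finite (outs F)"
  unfolding outs_def by (rule finite_outcomes)

lemma outs_simps [simp]:
  "outs (Var a) = {[]}"
  "outs (Neg G) = (#) 0 ` outs G"
  "outs (Conj G1 G2) = (#) 0 ` outs G1 \<union> (#) 1 ` outs G2"
  "outs (Disj G1 G2) = (#) 0 ` outs G1 \<union> (#) 1 ` outs G2"
  "outs (Choice G1 G2) = (#) 0 ` outs G1 \<union> (#) 1 ` outs G2"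
  unfolding outs_def[of "Var a"] outs_def[of "Neg G"] outs_def[of "Conj G1 G2"]
    outs_def[of "Disj G1 G2"] outs_def[of "Choice G1 G2"]
  by (simp_all add: outcomes_Node outcomes_game_tree lessThan_2 lessThan_Suc[of 0])

text \<open>The role at a node is that of the root, flipped once for every negation passed, so
  dualizing the root dualizes every node.\<close>

lemma state_at_dual:
  "p \<in> nodes (game_tree F Proponent) \<Longrightarrow>
    state_at (game_tree F (dual Q)) p = map_prod dual id (state_at (game_tree F Q) p)"
  by (induction F arbitrary: Q p) (auto simp: nodes_Node lessThan_2
      nodes_game_tree_role[of _ Opponent Proponent])

lemma true_state_dual:
  "p \<in> outs F \<Longrightarrow> true_state I (state_at (game_tree F (dual Q)) p) \<longleftrightarrow>
    \<not> true_state I (state_at (game_tree F Q) p)"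
proof (induction F arbitrary: Q p)
  case (Var a)
  then show ?case by (cases Q) auto
qed auto

section \<open>Lengths of preference chains and optionality\<close>

lemma in_child_iff [simp]:
  "(i # p, q) \<in> in_child j R \<longleftrightarrow> i = j \<and> (\<exists>r. q = i # r \<and> (p, r) \<in> R)"
  "(q, i # p) \<in> in_child j R \<longleftrightarrow> i = j \<and> (\<exists>r. q = i # r \<and> (r, p) \<in> R)"
  by (auto simp: in_child_def)

text \<open>As \<open>pref Opponent F\<close> is the converse of \<open>pref Proponent F\<close>,
  the role selects the direction: ascending chains for \<open>Proponent\<close>, descending ones for
  \<open>Opponent\<close>.\<close>

definition chain_len :: "role \<Rightarrow> 'u qcl \<Rightarrow> pos \<Rightarrow> nat" where
  "chain_len Q F p = max_chain (outs F) (pref Q F) p"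

lemma chain_len_Var: "chain_len Q (Var a) [] = 1"
proof -
  have "pref Q (Var a) = {}"
    by (cases Q) auto
  then show ?thesis
    unfolding chain_len_def
    by (intro max_chain_eqI[of _ _ _ "[[]]"])
      (auto simp: chain_from_def successively_conv_sorted_wrt neq_Nil_conv)
qed

lemma chain_len_Neg: "p \<in> outs G \<Longrightarrow> chain_len Q (Neg G) (0 # p) = chain_len (dual Q) G p"
  unfolding chain_len_def
  by (rule max_chain_embed; cases Q) (auto simp: finite_outs outcomes_game_tree)

text \<open>No preference links outcomes of different children, so chains stay within one
  child.\<close>

lemma chain_len_Conj:
  "p \<in> outs G1 \<Longrightarrow> chain_len Q (Conj G1 G2) (0 # p) = chain_len Q G1 p"
  "p \<in> outs G2 \<Longrightarrow> chain_len Q (Conj G1 G2) (1 # p) = chain_len Q G2 p"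
  unfolding chain_len_def
  by (rule max_chain_embed; cases Q; auto simp: finite_outs outcomes_game_tree)+

lemma chain_len_Disj:
  "p \<in> outs G1 \<Longrightarrow> chain_len Q (Disj G1 G2) (0 # p) = chain_len Q G1 p"
  "p \<in> outs G2 \<Longrightarrow> chain_len Q (Disj G1 G2) (1 # p) = chain_len Q G2 p"
  unfolding chain_len_def
  by (rule max_chain_embed; cases Q; auto simp: finite_outs outcomes_game_tree)+

text \<open>All outcomes of \<open>G1\<close> are preferred to those of \<open>G2\<close>, so
  ascending chains from \<open>G1\<close> and descending chains from \<open>G2\<close> cannot enter
  the other block.\<close>

lemma chain_len_Choice:
  "p \<in> outs G1 \<Longrightarrow> chain_len Proponent (Choice G1 G2) (0 # p) = chain_len Proponent G1 p"
  "p \<in> outs G2 \<Longrightarrow> chain_len Opponent (Choice G1 G2) (1 # p) = chain_len Opponent G2 p"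
  unfolding chain_len_def
  by (rule max_chain_embed; auto simp: finite_outs outcomes_game_tree)+

text \<open>An ascending chain from \<open>G2\<close> can continue with a longest chain of
  \<open>G1\<close>. Its length \<open>n\<close> stays abstract because this lemma serves in the
  induction that identifies \<open>n\<close> with \<open>opt G1\<close>.\<close>

lemma chain_len_Choice_shift:
  assumes "\<And>q. q \<in> outs G1 \<Longrightarrow> chain_len Proponent G1 q \<le> n"
    and "\<exists>q\<in>outs G1. chain_len Proponent G1 q = n"
    and "p \<in> outs G2"
  shows "chain_len Proponent (Choice G1 G2) (1 # p) = chain_len Proponent G2 p + n"
proof -
  obtain q where "q \<in> outs G1" "chain_len Proponent G1 q = n"
    using assms(2) by blast
  then show ?thesis
    using assms(1,3) unfolding chain_len_def
    by (intro max_chain_series[where b = q and g = "(#) 0"])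
      (auto simp: finite_outs outcomes_game_tree)
qed

lemma chain_len_Choice_shift':
  assumes "\<And>q. q \<in> outs G2 \<Longrightarrow> chain_len Opponent G2 q \<le> n"
    and "\<exists>q\<in>outs G2. chain_len Opponent G2 q = n"
    and "p \<in> outs G1"
  shows "chain_len Opponent (Choice G1 G2) (0 # p) = chain_len Opponent G1 p + n"
proof -
  obtain q where "q \<in> outs G2" "chain_len Opponent G2 q = n"
    using assms(2) by blast
  then show ?thesis
    using assms(1,3) unfolding chain_len_def
    by (intro max_chain_series[where b = q and g = "(#) 1"])
      (auto simp: finite_outs outcomes_game_tree)
qed

text \<open>Blocks side by side yield the maximum of their longest chains, stacked blocks the sum,
  just as \<open>opt\<close> does. The role is arbitrary since \<open>Neg\<close> reverses the
  direction of chains.\<close>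

lemma opt_is_max_chain_len:
  "(\<forall>p\<in>outs F. chain_len Q F p \<le> opt F) \<and> (\<exists>p\<in>outs F. chain_len Q F p = opt F)"
proof (induction F arbitrary: Q)
  case (Var a)
  then show ?case by (simp add: chain_len_Var)
next
  case (Neg F)
  then show ?case
    by (auto simp: chain_len_Neg)
next
  case (Conj F G)
  show ?case
    using Conj(1)[of Q] Conj(2)[of Q]
    by (cases "opt F \<le> opt G")
      (auto simp: chain_len_Conj[simplified] ball_Un bex_Un max_def intro: le_trans)
next
  case (Disj F G)
  show ?case
    using Disj(1)[of Q] Disj(2)[of Q]
    by (cases "opt F \<le> opt G")
      (auto simp: chain_len_Disj[simplified] ball_Un bex_Un max_def intro: le_trans)
next
  case (Choice F G)
  show ?case
  proof (cases Q)
    case Proponent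
    have "chain_len Proponent (Choice F G) (1 # p) = chain_len Proponent G p + opt F"
      if "p \<in> outs G" for p
      using Choice.IH(1) that by (intro chain_len_Choice_shift) auto
    then show ?thesis
      using Proponent Choice.IH[of Proponent]
      by (auto simp: chain_len_Choice ball_Un bex_Un intro: trans_le_add1)
  next
    case Opponent
    have "chain_len Opponent (Choice F G) (0 # p) = chain_len Opponent F p + opt G"
      if "p \<in> outs F" for p
      using Choice.IH(2) that by (intro chain_len_Choice_shift') auto
    then show ?thesis
      using Opponent Choice.IH[of Opponent]
      by (auto simp: chain_len_Choice[simplified] ball_Un bex_Un intro: trans_le_add2)
  qed
qed

lemma chain_len_Choice_opt:
  "p \<in> outs G2 \<Longrightarrow>
    chain_len Proponent (Choice G1 G2) (1 # p) = chain_len Proponent G2 p + opt G1"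
  "p \<in> outs G1 \<Longrightarrow>
    chain_len Opponent (Choice G1 G2) (0 # p) = chain_len Opponent G1 p + opt G2"
  using opt_is_max_chain_len[of G1 Proponent] opt_is_max_chain_len[of G2 Opponent]
  by (auto intro!: chain_len_Choice_shift[simplified] chain_len_Choice_shift')

section \<open>Payoffs and degrees\<close>

lemma chain_len_pos: "p \<in> outs F \<Longrightarrow> 0 < chain_len Q F p"
  unfolding chain_len_def by (rule max_chain_pos[OF finite_outs])

lemma Rep_payoff_chain_len:
  "p \<in> outs F \<Longrightarrow> Rep_nzint (payoff F I p) =
    (if true_state I (state_at (game_tree F Proponent) p) then int (chain_len Proponent F p)
     else - int (chain_len Opponent F p))"
  by (simp add: Rep_payoff chain_len_def outcomes_game_tree)

lemma payoff_Var: "payoff (Var a) I [] = deg I (Var a)"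
  by (simp add: Rep_payoff_chain_len chain_len_Var one_nzint.rep_eq uminus_nzint.rep_eq
      flip: Rep_nzint_inject)

text \<open>Negation flips the truth of an outcome and reverses the direction of chains at once, so
  the length that enters the payoff stays the same and only the sign changes.\<close>

lemma payoff_Neg: "p \<in> outs G \<Longrightarrow> payoff (Neg G) I (0 # p) = - payoff G I p"
  using true_state_dual[of p G I Proponent]
  by (simp add: Rep_payoff_chain_len chain_len_Neg uminus_nzint.rep_eq flip: Rep_nzint_inject)

lemma payoff_Conj:
  "p \<in> outs G1 \<Longrightarrow> payoff (Conj G1 G2) I (0 # p) = payoff G1 I p"
  "p \<in> outs G2 \<Longrightarrow> payoff (Conj G1 G2) I (1 # p) = payoff G2 I p"
  by (simp_all add: Rep_payoff_chain_len chain_len_Conj[simplified] flip: Rep_nzint_inject)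

lemma payoff_Disj:
  "p \<in> outs G1 \<Longrightarrow> payoff (Disj G1 G2) I (0 # p) = payoff G1 I p"
  "p \<in> outs G2 \<Longrightarrow> payoff (Disj G1 G2) I (1 # p) = payoff G2 I p"
  by (simp_all add: Rep_payoff_chain_len chain_len_Disj[simplified] flip: Rep_nzint_inject)

text \<open>Chain lengths are positive, so the sign of a payoff tells whether the outcome is true.
  Truth decides in which direction chains are measured, and thus whether they can cross into the
  other block.\<close>

lemma Rep_payoff_Choice:
  "p \<in> outs G1 \<Longrightarrow> Rep_nzint (payoff (Choice G1 G2) I (0 # p)) =
    (if 0 < Rep_nzint (payoff G1 I p) then Rep_nzint (payoff G1 I p)
     else Rep_nzint (payoff G1 I p) - int (opt G2))"
  "p \<in> outs G2 \<Longrightarrow> Rep_nzint (payoff (Choice G1 G2) I (1 # p)) =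
    (if 0 < Rep_nzint (payoff G2 I p) then int (opt G1) + Rep_nzint (payoff G2 I p)
     else Rep_nzint (payoff G2 I p))"
  using chain_len_pos[of p G1] chain_len_pos[of p G2]
  by (simp_all add: Rep_payoff_chain_len chain_len_Choice[simplified]
      chain_len_Choice_opt[simplified])

text \<open>This decides comparisons between the children of a \<open>Choice F G\<close>: shifted
  true payoffs of \<open>G\<close> exceed \<open>opt F\<close>, and shifted false payoffs of
  \<open>F\<close> lie below \<open>- opt G\<close> as integers, both out of reach of unshifted
  degrees.\<close>

lemma abs_deg_le_opt: "\<bar>Rep_nzint (deg I F)\<bar> \<le> int (opt F)"
proof (induction F)
  case (Choice F G)
  then show ?case
    unfolding Rep_deg_Choice by auto
qed (auto simp: one_nzint.rep_eq uminus_nzint.rep_eq min_def max_def)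

lemma uminus_nzint_le_iff [simp]: "- a \<le> - b \<longleftrightarrow> b \<le> (a :: nzint)"
  using Rep_nzint[of a] Rep_nzint[of b]
  by (auto simp: less_eq_nzint.rep_eq uminus_nzint.rep_eq)

lemma uminus_uminus_nzint [simp]: "- (- a) = (a :: nzint)"
  by transfer simp

section \<open>Securing the degree\<close>

text \<open>
  Strategies may contain nodes whose ancestors they omit; only outcomes all of whose prefixes
  belong to the strategy can be reached.
\<close>

definition secures :: "'u gtree \<Rightarrow> 'a::linorder \<Rightarrow> (pos \<Rightarrow> 'a) \<Rightarrow> bool" where
  "secures t v f \<longleftrightarrow> (\<exists>\<sigma>. strategy Me t \<sigma> \<and>
    (\<forall>p\<in>outcomes t. (\<forall>q. prefix q p \<longrightarrow> q \<in> \<sigma>) \<longrightarrow> v \<le> f p))"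

text \<open>The same strategy is kept. This carries a guarantee for a subformula over to the payoffs
  of the enclosing formula.\<close>

lemma secures_weaken:
  "secures t v f \<Longrightarrow> (\<And>p. p \<in> outcomes t \<Longrightarrow> v \<le> f p \<Longrightarrow> w \<le> g p) \<Longrightarrow> secures t w g"
  unfolding secures_def by meson

text \<open>\<open>J\<close> collects the children that the strategy keeps.\<close>

lemma strategy_Node:
  assumes "\<And>i. i \<in> J \<Longrightarrow> strategy X (ts ! i) (\<sigma> i)" and "J \<subseteq> {..<length ts}"
    and "if chooser s = Some X then \<exists>j. J = {j} else J = {..<length ts}"
  shows "strategy X (Node s ts) (insert [] (\<Union>i\<in>J. (#) i ` \<sigma> i))"
  unfolding strategy_def
proof (intro conjI ballI)
  let ?\<sigma> = "insert [] (\<Union>i\<in>J. (#) i ` \<sigma> i)"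
  show "?\<sigma> \<subseteq> nodes (Node s ts)"
    using assms(1,2) by (fastforce simp: nodes_Node strategy_def)
  show "[] \<in> ?\<sigma>" by simp
  fix v assume "v \<in> ?\<sigma>"
  then consider "v = []" | i u where "i \<in> J" "u \<in> \<sigma> i" "v = i # u" by auto
  then show "if chooser (state_at (Node s ts) v) = Some X
             then \<exists>!w. w \<in> successors (Node s ts) v \<and> w \<in> ?\<sigma>
             else successors (Node s ts) v \<subseteq> ?\<sigma>"
  proof cases
    case 1
    have "[] \<in> \<sigma> i" if "i \<in> J" for i
      using assms(1)[OF that] by (simp add: strategy_def)
    then show ?thesis
      using 1 assms(2,3) by (auto simp: successors_Node_Nil split: if_splits)
  next
    case 2
    then have i: "i < length ts"
      using assms(2) by auto
    have mem: "i # w \<in> ?\<sigma> \<longleftrightarrow> w \<in> \<sigma> i" for w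
      using 2 by auto
    have "if chooser (state_at (ts ! i) u) = Some X
          then \<exists>!w. w \<in> successors (ts ! i) u \<and> w \<in> \<sigma> i
          else successors (ts ! i) u \<subseteq> \<sigma> i"
      using assms(1)[OF 2(1)] 2(2) by (simp add: strategy_def)
    then show ?thesis
      using mem i unfolding 2(3) successors_Node_Cons[OF i] state_at_Node(2)[OF i]
      by (smt (verit, best) image_iff image_subset_iff subset_iff)
  qed
qed

lemma secures_leaf:
  assumes "chooser s \<noteq> Some Me" and "v \<le> f []"
  shows "secures (Node s []) v f"
  \<comment> \<open>A leaf has no children, so the family of child strategies is arbitrary.\<close>
  using strategy_Node[of "{}" Me "[]" undefined s] assms
  by (auto simp: secures_def outcomes_Node)

lemma secures_Node:
  assumes sec: "\<And>i. i \<in> J \<Longrightarrow> secures (ts ! i) v (\<lambda>p. f (i # p))"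
    and J: "J \<subseteq> {..<length ts}" "ts \<noteq> []"
    and ch: "if chooser s = Some Me then \<exists>j. J = {j} else J = {..<length ts}"
  shows "secures (Node s ts) v f"
proof -
  obtain \<sigma> where \<sigma>: "\<And>i. i \<in> J \<Longrightarrow> strategy Me (ts ! i) (\<sigma> i)"
    "\<And>i p. i \<in> J \<Longrightarrow> p \<in> outcomes (ts ! i) \<Longrightarrow> (\<forall>q. prefix q p \<longrightarrow> q \<in> \<sigma> i) \<Longrightarrow> v \<le> f (i # p)"
    using sec unfolding secures_def by metis
  let ?\<sigma> = "insert [] (\<Union>i\<in>J. (#) i ` \<sigma> i)"
  have "v \<le> f p" if p: "p \<in> outcomes (Node s ts)" and pre: "\<forall>q. prefix q p \<longrightarrow> q \<in> ?\<sigma>" for p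
  proof -
    obtain i u where u: "p = i # u" "u \<in> outcomes (ts ! i)"
      using p J(2) by (auto simp: outcomes_Node)
    \<comment> \<open>Putting \<open>i\<close> in front turns prefixes of \<open>u\<close> into
      prefixes of \<open>p\<close>; the empty prefix shows that child \<open>i\<close> was
      kept.\<close>
    have *: "i \<in> J \<and> q \<in> \<sigma> i" if "prefix q u" for q
      using pre[rule_format, of "i # q"] that u(1) by auto
    show ?thesis
      unfolding u(1) using *[of "[]"] * u(2) by (intro \<sigma>(2)) auto
  qed
  then show ?thesis
    using strategy_Node[OF \<sigma>(1) J(1) ch] unfolding secures_def by blast
qed

lemma secures_choose:
  assumes "chooser s = Some Me" and "i < length ts" and "secures (ts ! i) v (\<lambda>p. f (i # p))"
  shows "secures (Node s ts) v f"
  using assms by (intro secures_Node[of "{i}"]) auto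

lemma secures_all:
  assumes "chooser s \<noteq> Some Me" and "ts \<noteq> []"
    and "\<And>i. i < length ts \<Longrightarrow> secures (ts ! i) v (\<lambda>p. f (i # p))"
  shows "secures (Node s ts) v f"
  using assms by (intro secures_Node[of "{..<length ts}"]) auto

text \<open>Negation reverses the order on \<open>nzint\<close>, so securing a signed value as
  \<open>Opponent\<close> bounds the original payoff from above.\<close>

primrec signed :: "role \<Rightarrow> nzint \<Rightarrow> nzint" where
  "signed Proponent z = z"
| "signed Opponent z = - z"

lemma signed_dual: "signed (dual Q) z = signed Q (- z)"
  by (cases Q) simp_all

text \<open>Both roles share one induction because \<open>Neg\<close> exchanges them. Where Me
  chooses, the child with the favourable degree is picked; elsewhere the guarantees of all children
  combine.\<close>

lemma secures_deg:
  "secures (game_tree F Q) (signed Q (deg I F)) (\<lambda>p. signed Q (payoff F I p))"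
proof (induction F arbitrary: Q)
  case (Var a)
  then show ?case
    by (cases Q) (auto intro!: secures_leaf simp: payoff_Var simp del: deg.simps)
next
  case (Neg F)
  show ?case
    unfolding game_tree.simps
  proof (rule secures_all)
    fix i assume "i < length [game_tree F (dual Q)]"
    then show "secures ([game_tree F (dual Q)] ! i) (signed Q (deg I (Neg F)))
      (\<lambda>p. signed Q (payoff (Neg F) I (i # p)))"
      by (auto simp: payoff_Neg outcomes_game_tree signed_dual
          intro!: secures_weaken[OF Neg[of "dual Q"]])
  qed (cases Q; simp)+
next
  case (Conj F G)
  show ?case
  proof (cases Q)
    case Proponent
    show ?thesis
      unfolding Proponent game_tree.simps
      by (rule secures_all)
        (auto simp: less_Suc_eq payoff_Conj[simplified] min_le_iff_disj
          outcomes_game_tree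
          intro!: secures_weaken[OF Conj.IH(1)[of Proponent]]
            secures_weaken[OF Conj.IH(2)[of Proponent]])
  next
    case Opponent
    show ?thesis
    proof (cases "deg I F \<le> deg I G")
      case True
      then show ?thesis
        unfolding Opponent game_tree.simps
        by (intro secures_choose[where i = 0])
          (auto simp: payoff_Conj outcomes_game_tree min_def
            intro!: secures_weaken[OF Conj.IH(1)[of Opponent]])
    next
      case False
      then show ?thesis
        unfolding Opponent game_tree.simps
        by (intro secures_choose[where i = 1])
          (auto simp: payoff_Conj[simplified] outcomes_game_tree min_def
            intro!: secures_weaken[OF Conj.IH(2)[of Opponent]])
    qed
  qed
next
  case (Disj F G)
  show ?case
  proof (cases Q)
    case Opponent
    show ?thesis
      unfolding Opponent game_tree.simps
      by (rule secures_all)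
        (auto simp: less_Suc_eq payoff_Disj[simplified] le_max_iff_disj outcomes_game_tree
          intro!: secures_weaken[OF Disj.IH(1)[of Opponent]]
            secures_weaken[OF Disj.IH(2)[of Opponent]])
  next
    case Proponent
    show ?thesis
    proof (cases "deg I F \<le> deg I G")
      case False
      then show ?thesis
        unfolding Proponent game_tree.simps
        by (intro secures_choose[where i = 0])
          (auto simp: payoff_Disj outcomes_game_tree max_def
            intro!: secures_weaken[OF Disj.IH(1)[of Proponent]])
    next
      case True
      then show ?thesis
        unfolding Proponent game_tree.simps
        by (intro secures_choose[where i = 1])
          (auto simp: payoff_Disj[simplified] outcomes_game_tree max_def
            intro!: secures_weaken[OF Disj.IH(2)[of Proponent]])
    qed
  qed
next
  case (Choice F G)
  note nz = Rep_nzint[of "deg I F", simplified] Rep_nzint[of "deg I G", simplified]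
  note bounds = abs_deg_le_opt[of I F] abs_deg_le_opt[of I G]
  note rep = less_eq_nzint.rep_eq Rep_deg_Choice
  show ?case
  proof (cases Q)
    case Opponent
    have 0: "payoff (Choice F G) I (0 # p) \<le> deg I (Choice F G)"
      if "p \<in> outs F" "payoff F I p \<le> deg I F" for p
      using that(2) nz bounds Rep_nzint[of "payoff F I p"]
      unfolding rep Rep_payoff_Choice(1)[OF that(1)] by auto
    \<comment> \<open>Here \<open>bounds\<close> matters. A positive \<open>deg I F\<close> is at
      most \<open>opt F\<close>, so shifted true payoffs of \<open>G\<close> rank below it. If both
      degrees are negative, \<open>deg I G\<close> is at least \<open>- opt G\<close> as an integer,
      so payoffs up to \<open>deg I G\<close> rank below the shifted degree of
      \<open>F\<close>.\<close>
    have 1: "payoff (Choice F G) I (1 # p) \<le> deg I (Choice F G)"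
      if "p \<in> outs G" "payoff G I p \<le> deg I G" for p
      using that(2) nz bounds Rep_nzint[of "payoff G I p"]
      unfolding rep Rep_payoff_Choice(2)[OF that(1)] by auto
    show ?thesis
      unfolding Opponent game_tree.simps
      by (rule secures_all)
        (auto simp: less_Suc_eq outcomes_game_tree 0 1[unfolded One_nat_def] simp del: deg.simps
          intro!: secures_weaken[OF Choice.IH(1)[of Opponent]]
            secures_weaken[OF Choice.IH(2)[of Opponent]])
  next
    case Proponent
    show ?thesis
    \<comment> \<open>If both degrees are negative, \<open>F\<close> is still the better child:
      subtracting \<open>opt G\<close> moves its degree below \<open>- opt G\<close> as an integer,
      which is higher in the order.\<close>
    proof (cases "Rep_nzint (deg I F) < 0 \<and> 0 < Rep_nzint (deg I G)")
      case False
      have "deg I (Choice F G) \<le> payoff (Choice F G) I (0 # p)"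
        if "p \<in> outs F" "deg I F \<le> payoff F I p" for p
        using that(2) nz bounds Rep_nzint[of "payoff F I p"] False
        unfolding rep Rep_payoff_Choice(1)[OF that(1)] by auto
      then show ?thesis
        unfolding Proponent game_tree.simps
        by (intro secures_choose[where i = 0])
          (auto simp: outcomes_game_tree simp del: deg.simps
            intro!: secures_weaken[OF Choice.IH(1)[of Proponent]])
    next
      case True
      have "deg I (Choice F G) \<le> payoff (Choice F G) I (1 # p)"
        if "p \<in> outs G" "deg I G \<le> payoff G I p" for p
        using that(2) nz bounds Rep_nzint[of "payoff G I p"] True
        unfolding rep Rep_payoff_Choice(2)[OF that(1)] by auto
      then show ?thesis
        unfolding Proponent game_tree.simps
        by (intro secures_choose[where i = 1])
          (auto simp: outcomes_game_tree simp del: deg.simps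
            intro!: secures_weaken[OF Choice.IH(2)[of Proponent]])
    qed
  qed
qed

section \<open>Exchanging the players, and the value of the game\<close>

lemma chooser_dual: "chooser (map_prod dual id s) = Some Me \<longleftrightarrow> chooser s = Some You"
  by (cases s rule: chooser.cases) auto

text \<open>Exchanging roles hands exactly the choices of You over to Me and leaves positions alone.
  Guarantees of Me in the opponent game thereby become guarantees of You in the original
  one.\<close>

lemma strategy_You_iff:
  "strategy You (game_tree F Proponent) \<sigma> \<longleftrightarrow> strategy Me (game_tree F Opponent) \<sigma>"
proof -
  have "chooser (state_at (game_tree F Opponent) v) = Some Me \<longleftrightarrow>
      chooser (state_at (game_tree F Proponent) v) = Some You"
    if "v \<in> nodes (game_tree F Proponent)" for v
    using state_at_dual[OF that, of Proponent] by (simp add: chooser_dual)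
  then show ?thesis
    unfolding strategy_def nodes_game_tree_role[of F Opponent Proponent]
      successors_game_tree_role[of F Opponent Proponent]
    by (intro conj_cong ball_cong if_cong refl) auto
qed

theorem theorem2:
  fixes F :: "'u::infinite qcl" and I :: "'u set"
  shows "game_value F I = deg I F"
proof -
  let ?t = "game_tree F Proponent"
  let ?Me = "{\<sigma>. strategy Me ?t \<sigma>}" and ?You = "{\<sigma>. strategy You ?t \<sigma>}"
  let ?v = "\<lambda>\<sigma> \<tau>. payoff F I (the_outcome ?t \<sigma> \<tau>)"
  have out: "is_outcome ?t \<sigma> \<tau> (the_outcome ?t \<sigma> \<tau>)" if "\<sigma> \<in> ?Me" "\<tau> \<in> ?You" for \<sigma> \<tau>
    unfolding the_outcome_def using that by (simp add: theI'[OF unique_outcome])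
  obtain \<sigma> where "strategy Me ?t \<sigma>"
      and "\<And>p. p \<in> outcomes ?t \<Longrightarrow> \<forall>q. prefix q p \<longrightarrow> q \<in> \<sigma> \<Longrightarrow> deg I F \<le> payoff F I p"
    using secures_deg[of F Proponent I] by (auto simp: secures_def)
  \<comment> \<open>All prefixes of the outcome of two strategies lie in both of them, so the
    guarantee applies to every play.\<close>
  then have \<sigma>: "\<sigma> \<in> ?Me" "\<And>\<tau>. \<tau> \<in> ?You \<Longrightarrow> deg I F \<le> ?v \<sigma> \<tau>"
    using out unfolding is_outcome_def mem_Collect_eq by metis+
  \<comment> \<open>The opponent half of \<open>secures_deg\<close> supplies a strategy of You;
    cancelling the negations reverses the inequality.\<close>
  obtain \<tau> where "strategy You ?t \<tau>"
      and "\<And>p. p \<in> outcomes ?t \<Longrightarrow> \<forall>q. prefix q p \<longrightarrow> q \<in> \<tau> \<Longrightarrow> payoff F I p \<le> deg I F"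
    using secures_deg[of F Opponent I]
    by (auto simp: secures_def strategy_You_iff outcomes_game_tree)
  then have \<tau>: "\<tau> \<in> ?You" "\<And>\<sigma>. \<sigma> \<in> ?Me \<Longrightarrow> ?v \<sigma> \<tau> \<le> deg I F"
    using out unfolding is_outcome_def mem_Collect_eq by metis+
  note fin = finite_strategies[of Me ?t] finite_strategies[of You ?t]
  have upper: "(MIN \<tau>\<in>?You. ?v \<sigma> \<tau>) \<le> deg I F" if "\<sigma> \<in> ?Me" for \<sigma>
    using \<tau> that fin by (intro order_trans[OF Min_le \<tau>(2)[OF that]]) auto
  have lower: "deg I F \<le> (MIN \<tau>\<in>?You. ?v \<sigma> \<tau>)"
    using \<sigma>(2) \<tau>(1) fin by (subst Min_ge_iff) auto
  \<comment> \<open>The strategy \<sigma> attains the maximum, and \<tau> keeps the minimum for any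
    other strategy from exceeding it.\<close>
  have "(MAX \<sigma>\<in>?Me. MIN \<tau>\<in>?You. ?v \<sigma> \<tau>) = deg I F"
  proof (rule Max_eqI)
    show "deg I F \<in> (\<lambda>\<sigma>. MIN \<tau>\<in>?You. ?v \<sigma> \<tau>) ` ?Me"
      using upper[OF \<sigma>(1)] lower \<sigma>(1) by (intro image_eqI[of _ _ \<sigma>]) auto
  qed (use fin upper in auto)
  then show ?thesis
    by (simp add: game_value_def Let_def)
qed

end
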